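(* Let $m$ be a positive integer and let $p$ be a prime with $p\equiv 1\pmod{2m}$. Suppose that $2$ is an $m$th power residue modulo $p$. Then for any integer $a\not\equiv 0\pmod p$, we have $$\prod_{k\in R_m(p)}\left(i-e^{2\pi i a k/p}\right)=\left(\frac{-2}{p}\right)_{2m} i^{(p-1)/(2m)}$$ and $$\prod_{k\in R_m(p)}\left(i+e^{2\pi i a k/p}\right)=\left(\frac{2}{p}\right)_{2m} i^{(p-1)/(2m)},$$ where $i=\sqrt{-1}$.
   Context: For a positive integer $m$ and a prime $p\equiv 1\pmod m$, an integer $b\not\equiv 0\pmod p$ is an $m$th power residue modulo $p$ if $x^m\equiv b\pmod p$ for some integer $x$, and $R_m(p)=\{k\in\{1,\ldots,p-1\}:\ k \text{ is an } m\text{th power residue modulo } p\}$. For a positive integer $n$ with $p\equiv1\pmod n$ and an integer $b\not\equiv0\pmod p$, the $n$th power residue symbol $\left(\frac{b}{p}\right)_n$ is the unique $n$th root of unity $\zeta$ such that $b^{(p-1)/n}\equiv\zeta\pmod p$ in the ring of all algebraic integers. *)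

theory Defs
  imports "HOL-Analysis.Analysis" "HOL-Computational_Algebra.Computational_Algebra"
    "HOL-Number_Theory.Number_Theory"
begin

definition is_power_residue :: "nat \<Rightarrow> nat \<Rightarrow> int \<Rightarrow> bool" where
  "is_power_residue m p b \<longleftrightarrow> \<not> [b = 0] (mod int p) \<and> (\<exists>x::int. [x ^ m = b] (mod int p))"

definition power_residues :: "nat \<Rightarrow> nat \<Rightarrow> nat set" where
  "power_residues m p = {k \<in> {1..p - 1}. is_power_residue m p (int k)}"

definition alg_int_cong :: "nat \<Rightarrow> complex \<Rightarrow> complex \<Rightarrow> bool" where
  "alg_int_cong p x y \<longleftrightarrow> (\<exists>w::complex. algebraic_int w \<and> x - y = of_nat p * w)"

text \<open>
  The \<open>n\<close>-th power residue symbol of \<open>b\<close> modulo a prime \<open>p\<close> with \<open>p \<equiv> 1 (mod n)\<close> and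
  \<open>p\<close> not dividing \<open>b\<close>. The congruence is modulo the ideal generated by the rational prime \<open>p\<close> in
  the ring of all algebraic integers. For odd \<open>p\<close> and such \<open>n\<close> and \<open>b\<close>, a root of unity
  \<open>\<zeta>\<close> as required exists (and is then unique) only if \<open>b\<close> to the power \<open>(p - 1) / n\<close> is
  \<open>1\<close>, or \<open>n\<close> is even and that power is \<open>-1\<close>, modulo \<open>p\<close>; otherwise the description is
  unspecified. If \<open>p \<equiv> 1 (mod 2m)\<close> and \<open>2\<close> is an \<open>m\<close>-th power residue modulo \<open>p\<close>, this
  condition holds for \<open>n = 2m\<close> and \<open>b = 2\<close> or \<open>b = -2\<close>.
\<close>
definition power_residue_symbol :: "int \<Rightarrow> nat \<Rightarrow> nat \<Rightarrow> complex" where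
  "power_residue_symbol b p n =
     (THE \<zeta>. \<zeta> ^ n = 1 \<and> alg_int_cong p (of_int b ^ ((p - 1) div n)) \<zeta>)"

end

theory Submission
  imports Defs "Jordan_Normal_Form.Char_Poly"
begin

text \<open>
  Write \<open>z = e\<^bsup>2\<pi>ia/p\<^esup>\<close> and \<open>n = (p - 1) / (2m)\<close>, and call the two products \<open>A\<close> and \<open>B\<close>. Since
  \<open>- 1\<close> is an \<open>m\<close>-th power residue, pairing \<open>k\<close> with \<open>p - k\<close> gives \<open>A = (-i)\<^sup>n C\<close> and \<open>B = i\<^sup>n C\<close>,
  where \<open>C\<close> is the product of the \<open>n\<close> numbers \<open>z\<^sup>k + z\<^bsup>p-k\<^esup>\<close>, \<open>k < p/2\<close>. As \<open>2\<close> is a residue as well,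
  \<open>k \<mapsto> 2k\<close> permutes the residues, so \<open>AB\<close>, which is the product of the \<open>1 + z\<^bsup>2k\<^esup>\<close>, equals that of
  the \<open>1 + z\<^sup>k = (1 - z\<^bsup>2k\<^esup>) / (1 - z\<^sup>k)\<close>, which telescopes to \<open>1\<close>. Hence \<open>C\<^sup>2 = 1\<close>. Finally
  \<open>C = C\<^sup>p \<equiv> 2\<^sup>n (mod p)\<close>, because \<open>(z\<^sup>k + z\<^bsup>p-k\<^esup>)\<^sup>p \<equiv> z\<^bsup>kp\<^esup> + z\<^bsup>(p-k)p\<^esup> = 2\<close>. So \<open>C\<close> and \<open>(-1)\<^sup>n C\<close> are
  the power residue symbols of \<open>2\<close> and \<open>-2\<close>.
\<close>

section \<open>The ring of algebraic integers\<close>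

lemma int_module: "Modules.module (\<lambda>(c::int) (x::'a::field_char_0). of_int c * x)"
  by unfold_locales (auto simp: algebra_simps)

lemma algebraic_int_if_stable_module:
  fixes x :: "'a :: field_char_0"
  assumes fin: "finite S" and nz: "\<exists>s\<in>S. s \<noteq> 0"
    and stable: "\<And>s. s \<in> S \<Longrightarrow> x * s \<in> Modules.module.span (\<lambda>(c::int) (x::'a). of_int c * x) S"
  shows "algebraic_int x"
  \<comment> \<open>\<open>x\<close> is an eigenvalue, with eigenvector \<open>S\<close>, of the integer matrix of multiplication by \<open>x\<close>.\<close>
proof -
  interpret M: Modules.module "\<lambda>(c::int) (x::'a). of_int c * x" by (rule int_module)
  have "\<exists>c::'a \<Rightarrow> int. x * s = (\<Sum>t\<in>S. of_int (c t) * t)" if "s \<in> S" for s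
    using stable[OF that] unfolding M.span_finite[OF fin] by auto
  then obtain c :: "'a \<Rightarrow> 'a \<Rightarrow> int"
    where c: "\<And>s. s \<in> S \<Longrightarrow> x * s = (\<Sum>t\<in>S. of_int (c s t) * t)" by metis
  obtain xs where xs: "set xs = S" "distinct xs" using finite_distinct_list[OF fin] by auto
  define n where "n = length xs"
  define A where "A = mat n n (\<lambda>(i,j). c (xs ! i) (xs ! j))"
  have A: "A \<in> carrier_mat n n" by (simp add: A_def)
  define v where "v = vec n (\<lambda>i. xs ! i)"
  have "eigenvector (map_mat (of_int :: int \<Rightarrow> 'a) A) v x"
    unfolding eigenvector_def
  proof (intro conjI)
    show "v \<in> carrier_vec (dim_row (map_mat (of_int :: int \<Rightarrow> 'a) A))"
      by (simp add: v_def A_def)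
    obtain i where "i < n" "xs ! i \<noteq> 0"
      using nz xs unfolding n_def by (metis in_set_conv_nth)
    then show "v \<noteq> 0\<^sub>v (dim_row (map_mat (of_int :: int \<Rightarrow> 'a) A))"
      by (auto simp: v_def A_def vec_eq_iff)
    have "(map_mat (of_int :: int \<Rightarrow> 'a) A *\<^sub>v v) $ i = (x \<cdot>\<^sub>v v) $ i" if i: "i < n" for i
    proof -
      have "xs ! i \<in> S" using i xs n_def by auto
      then have "x * (xs ! i) = (\<Sum>t\<in>S. of_int (c (xs ! i) t) * t)" by (rule c)
      also have "\<dots> = (\<Sum>j<n. of_int (c (xs ! i) (xs ! j)) * (xs ! j))"
        using sum.reindex_bij_betw[OF bij_betw_nth[OF xs(2) refl refl], of "\<lambda>t. of_int (c (xs ! i) t) * t"]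
        by (simp add: xs(1) n_def)
      finally show ?thesis using i
        by (simp add: A_def v_def scalar_prod_def atLeast0LessThan)
    qed
    then show "map_mat (of_int :: int \<Rightarrow> 'a) A *\<^sub>v v = x \<cdot>\<^sub>v v"
      by (intro eq_vecI) (auto simp: v_def A_def)
  qed
  then have "poly (char_poly (map_mat (of_int :: int \<Rightarrow> 'a) A)) x = 0"
    using eigenvalue_root_char_poly[of "map_mat of_int A" n x] A
    by (auto simp: eigenvalue_def)
  \<comment> \<open>The characteristic polynomial of the integer matrix \<open>A\<close> is monic
    with integer coefficients, so it witnesses the integrality of its root \<open>x\<close>.\<close>
  then have "poly (map_poly of_int (char_poly A)) x = 0"
    by (simp add: of_int_hom.char_poly_hom[OF A])
  moreover have "lead_coeff (char_poly A) = 1"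
    using degree_monic_char_poly[OF A] by simp
  ultimately show ?thesis by (auto simp: algebraic_int_altdef_ipoly)
qed

text \<open>The monomials \<open>x ^ i * y ^ j\<close> below the degrees of two monic relations span
  a finitely generated group that is stable under both \<open>x\<close> and \<open>y\<close>. It is
  therefore stable under \<open>x + y\<close> and \<open>x * y\<close>, and one set \<open>S\<close>
  serves for both.\<close>

lemma algebraic_int_ring_generated:
  fixes x y z :: "'a :: field_char_0"
  assumes "algebraic_int x" "algebraic_int y"
    and z: "z = x + y \<or> z = x * y"
  shows "algebraic_int z"
proof -
  interpret M: Modules.module "\<lambda>(c::int) (x::'a). of_int c * x" by (rule int_module)
  have monic: "\<exists>m>0. \<exists>c::nat \<Rightarrow> int. u ^ m = (\<Sum>k<m. of_int (c k) * u ^ k)"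
    if alg: "algebraic_int u" for u :: 'a
  proof -
    obtain P where P: "poly (map_poly (of_int :: int \<Rightarrow> 'a) P) u = 0" "lead_coeff P = 1"
      using alg unfolding algebraic_int_altdef_ipoly by auto
    \<comment> \<open>A constant monic polynomial is 1 and has no root. Positive degrees put
      \<open>1 = x ^ 0 * y ^ 0\<close> into \<open>S\<close>, which is the nonzero element required
      later.\<close>
    have deg: "degree P > 0"
    proof (rule ccontr)
      assume "\<not> degree P > 0"
      then obtain d where "P = [:d:]" by (metis degree_eq_zeroE neq0_conv)
      with P show False by (simp split: if_splits)
    qed
    have "0 = (\<Sum>k\<le>degree P. of_int (Polynomial.coeff P k) * u ^ k)"
      using P(1) by (simp add: poly_altdef)
    also have "\<dots> = (\<Sum>k<degree P. of_int (Polynomial.coeff P k) * u ^ k) + u ^ degree P"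
      using P(2) by (simp add: lessThan_Suc_atMost[symmetric])
    finally have "u ^ degree P = (\<Sum>k<degree P. of_int (- Polynomial.coeff P k) * u ^ k)"
      by (simp add: sum_negf eq_neg_iff_add_eq_0 add.commute)
    with deg show ?thesis by (intro exI[of _ "degree P"] conjI exI[of _ "\<lambda>k. - Polynomial.coeff P k"]) auto
  qed
  obtain m c where m: "m > 0" "x ^ m = (\<Sum>k<m. of_int (c k :: int) * x ^ k)"
    using monic assms(1) by metis
  obtain n d where n: "n > 0" "y ^ n = (\<Sum>k<n. of_int (d k :: int) * y ^ k)"
    using monic assms(2) by metis
  define S where "S = (\<lambda>(i, j). x ^ i * y ^ j) ` ({..<m} \<times> {..<n})"
  have base: "x ^ i * y ^ j \<in> M.span S" if "i < m" "j < n" for i j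
    using that by (intro M.span_base) (auto simp: S_def)
  have x: "x * s \<in> M.span S" if s: "s \<in> S" for s
  proof -
    obtain i j where ij: "i < m" "j < n" "s = x ^ i * y ^ j" using s by (auto simp: S_def)
    show ?thesis
    proof (cases "Suc i < m")
      case True
      then show ?thesis using base[of "Suc i" j] ij by (simp add: mult.assoc)
    next
      case False
      \<comment> \<open>At the top exponent the product leaves \<open>S\<close>, and the monic
        relation for \<open>x ^ m\<close> brings it back into the span.\<close>
      then have "Suc i = m" using ij by simp
      then have "x * s = x ^ m * y ^ j" using ij by (auto simp: mult.assoc)
      also have "\<dots> = (\<Sum>k<m. of_int (c k) * (x ^ k * y ^ j))"
        by (simp add: m sum_distrib_right mult.assoc)
      also have "\<dots> \<in> M.span S"
        using ij by (intro M.span_sum M.span_scale base) auto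
      finally show ?thesis .
    qed
  qed
  have y: "y * s \<in> M.span S" if s: "s \<in> S" for s
  proof -
    obtain i j where ij: "i < m" "j < n" "s = x ^ i * y ^ j" using s by (auto simp: S_def)
    show ?thesis
    proof (cases "Suc j < n")
      case True
      then show ?thesis using base[of i "Suc j"] ij by (simp add: algebra_simps)
    next
      case False
      then have "Suc j = n" using ij by simp
      then have "y * s = x ^ i * y ^ n" using ij by (auto simp: algebra_simps)
      also have "\<dots> = (\<Sum>k<n. of_int (d k) * (x ^ i * y ^ k))"
        by (simp add: n sum_distrib_left algebra_simps)
      also have "\<dots> \<in> M.span S"
        using ij by (intro M.span_sum M.span_scale base) auto
      finally show ?thesis .
    qed
  qed
  \<comment> \<open>For the product, \<open>y * s\<close> lies only in the span and not in
    \<open>S\<close>, so stability under \<open>x\<close> is extended to the whole span.\<close>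
  have x': "x * t \<in> M.span S" if "t \<in> M.span S" for t
    using that
  proof (induction rule: M.span_induct_alt)
    case (step c s t)
    have "of_int c * (x * s) + x * t \<in> M.span S"
      using step x by (intro M.span_add M.span_scale) auto
    then show ?case by (simp add: algebra_simps)
  qed (simp add: M.span_zero)
  show ?thesis
  proof (rule algebraic_int_if_stable_module)
    show "finite S" by (simp add: S_def)
    show "\<exists>s\<in>S. s \<noteq> 0"
      using m n by (intro bexI[of _ 1]) (auto simp: S_def intro!: image_eqI[of _ _ "(0, 0)"])
    show "z * s \<in> M.span S" if "s \<in> S" for s
      using z M.span_add[OF x[OF that] y[OF that]] x'[OF y[OF that]]
      by (auto simp: distrib_right mult.assoc)
  qed
qed

lemma algebraic_int_add:
  "algebraic_int x \<Longrightarrow> algebraic_int y \<Longrightarrow> algebraic_int (x + y :: 'a :: field_char_0)"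
  using algebraic_int_ring_generated by blast

lemma algebraic_int_mult:
  "algebraic_int x \<Longrightarrow> algebraic_int y \<Longrightarrow> algebraic_int (x * y :: 'a :: field_char_0)"
  using algebraic_int_ring_generated by blast

lemma algebraic_int_sum:
  "(\<And>k. k \<in> K \<Longrightarrow> algebraic_int (f k)) \<Longrightarrow> algebraic_int (\<Sum>k\<in>K. f k :: 'a :: field_char_0)"
  by (induction K rule: infinite_finite_induct) (auto intro: algebraic_int_add)

lemma algebraic_int_prod:
  "(\<And>k. k \<in> K \<Longrightarrow> algebraic_int (f k)) \<Longrightarrow> algebraic_int (\<Prod>k\<in>K. f k :: 'a :: field_char_0)"
  by (induction K rule: infinite_finite_induct) (auto intro: algebraic_int_mult)

lemma algebraic_int_power:
  "algebraic_int x \<Longrightarrow> algebraic_int (x ^ n :: 'a :: field_char_0)"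
  by (induction n) (auto intro: algebraic_int_mult)

lemma algebraic_int_root_of_unity:
  fixes x :: "'a :: field_char_0"
  assumes "n > 0" "x ^ n = 1"
  shows "algebraic_int x"
  by (rule algebraic_int_root[of 1 "Polynomial.monom 1 n"])
     (use assms in \<open>auto simp: poly_monom Polynomial.degree_monom_eq\<close>)

section \<open>Congruences between algebraic integers\<close>

lemma alg_int_cong_refl: "alg_int_cong p x x"
  unfolding alg_int_cong_def by (intro exI[of _ 0]) auto

lemma alg_int_cong_trans [trans]:
  assumes "alg_int_cong p x y" "alg_int_cong p y z"
  shows "alg_int_cong p x z"
proof -
  obtain v w where "algebraic_int v" "x - y = of_nat p * v" "algebraic_int w" "y - z = of_nat p * w"
    using assms unfolding alg_int_cong_def by auto
  then show ?thesis unfolding alg_int_cong_def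
    by (intro exI[of _ "v + w"]) (auto simp: algebraic_int_add algebra_simps)
qed

lemma alg_int_cong_sym:
  assumes "alg_int_cong p x y"
  shows "alg_int_cong p y x"
proof -
  obtain v where "algebraic_int v" "x - y = of_nat p * v"
    using assms unfolding alg_int_cong_def by auto
  then show ?thesis unfolding alg_int_cong_def
    by (intro exI[of _ "- v"]) (auto simp: algebra_simps)
qed

lemma alg_int_cong_add:
  assumes "alg_int_cong p x y" "alg_int_cong p x' y'"
  shows "alg_int_cong p (x + x') (y + y')"
proof -
  obtain v w where "algebraic_int v" "x - y = of_nat p * v" "algebraic_int w" "x' - y' = of_nat p * w"
    using assms unfolding alg_int_cong_def by auto
  then show ?thesis unfolding alg_int_cong_def
    by (intro exI[of _ "v + w"]) (auto simp: algebraic_int_add algebra_simps)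
qed

text \<open>Integrality is asked of \<open>y\<close> and \<open>x'\<close> because these are the
  factors that multiply the two quotients in \<open>(x - y) * x' + y * (x' - y')\<close>.\<close>

lemma alg_int_cong_mult:
  assumes "alg_int_cong p x y" "alg_int_cong p x' y'" "algebraic_int y" "algebraic_int x'"
  shows "alg_int_cong p (x * x') (y * y')"
proof -
  obtain v w where vw: "algebraic_int v" "x - y = of_nat p * v"
    "algebraic_int w" "x' - y' = of_nat p * w"
    using assms unfolding alg_int_cong_def by auto
  have "x * x' - y * y' = (x - y) * x' + y * (x' - y')" by (simp add: algebra_simps)
  also have "\<dots> = of_nat p * (v * x' + y * w)" by (simp add: vw algebra_simps)
  finally show ?thesis unfolding alg_int_cong_def
    using vw assms by (intro exI[of _ "v * x' + y * w"]) (auto intro: algebraic_int_add algebraic_int_mult)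
qed

lemma alg_int_cong_sum:
  assumes "\<And>k. k \<in> K \<Longrightarrow> alg_int_cong p (f k) (g k)"
  shows "alg_int_cong p (\<Sum>k\<in>K. f k) (\<Sum>k\<in>K. g k)"
  using assms
  by (induction K rule: infinite_finite_induct) (auto intro: alg_int_cong_refl alg_int_cong_add)

lemma alg_int_cong_prod:
  assumes "\<And>k. k \<in> K \<Longrightarrow> alg_int_cong p (f k) (g k)"
    and "\<And>k. k \<in> K \<Longrightarrow> algebraic_int (f k)" "\<And>k. k \<in> K \<Longrightarrow> algebraic_int (g k)"
  shows "alg_int_cong p (\<Prod>k\<in>K. f k) (\<Prod>k\<in>K. g k)"
  using assms
  by (induction K rule: infinite_finite_induct)
     (auto intro!: alg_int_cong_refl alg_int_cong_mult algebraic_int_prod)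

lemma alg_int_cong_power:
  assumes "alg_int_cong p x y" "algebraic_int x" "algebraic_int y"
  shows "alg_int_cong p (x ^ n) (y ^ n)"
  using alg_int_cong_prod[of "{..<n}" p "\<lambda>_. x" "\<lambda>_. y"] assms by simp

text \<open>The inner binomial coefficients are divisible by the prime \<open>p\<close>;
  \<open>h\<close> collects the terms after division by \<open>p\<close>, and these are still
  algebraic integers.\<close>

lemma alg_int_cong_frobenius:
  assumes "prime p" "algebraic_int x" "algebraic_int y"
  shows "alg_int_cong p ((x + y) ^ p) (x ^ p + y ^ p)"
proof -
  define f where "f k = of_nat (p choose k) * x ^ k * y ^ (p - k)" for k
  define h where "h k = of_nat ((p choose k) div p) * x ^ k * y ^ (p - k)" for k
  have p: "p > 0" using assms prime_gt_0_nat by simp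
  have "(x + y) ^ p = (\<Sum>k\<le>p. f k)" by (simp add: f_def binomial_ring)
  also have "{..p} = insert 0 (insert p {0<..<p})" using p by auto
  also have "(\<Sum>k\<in>insert 0 (insert p {0<..<p}). f k) = y ^ p + x ^ p + (\<Sum>k\<in>{0<..<p}. f k)"
    using p by (simp add: f_def)
  also have "(\<Sum>k\<in>{0<..<p}. f k) = (\<Sum>k\<in>{0<..<p}. of_nat p * h k)"
  proof (rule sum.cong)
    fix k assume "k \<in> {0<..<p}"
    then have "p dvd (p choose k)" using assms by (intro dvd_choose_prime) auto
    then have "(of_nat (p choose k) :: complex) = of_nat p * of_nat ((p choose k) div p)"
      by (metis dvd_mult_div_cancel of_nat_mult)
    then show "f k = of_nat p * h k" by (simp add: f_def h_def mult.assoc)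
  qed auto
  finally have "(x + y) ^ p - (x ^ p + y ^ p) = of_nat p * (\<Sum>k\<in>{0<..<p}. h k)"
    by (simp add: sum_distrib_left)
  moreover have "algebraic_int (\<Sum>k\<in>{0<..<p}. h k)"
    unfolding h_def using assms
    by (intro algebraic_int_sum algebraic_int_mult algebraic_int_power) auto
  ultimately show ?thesis unfolding alg_int_cong_def by blast
qed

text \<open>Otherwise n/p would be a rational algebraic integer, hence an integer.\<close>

lemma not_alg_int_cong_0:
  assumes "\<not> p dvd n"
  shows "\<not> alg_int_cong p (of_nat n) 0"
proof
  assume "alg_int_cong p (of_nat n) 0"
  then obtain w where w: "algebraic_int w" "(of_nat n :: complex) = of_nat p * w"
    unfolding alg_int_cong_def by auto
  \<comment> \<open>If \<open>p\<close> were 0, then \<open>n\<close> would be 0 as well, and 0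
    divides 0.\<close>
  have "p > 0" using w assms by (intro Nat.gr0I) auto
  then have "w = of_nat n / of_nat p" using w by (simp add: field_simps)
  then have "w \<in> \<rat>" by simp
  with w obtain k where "w = of_int k"
    using rational_algebraic_int_is_int Ints_cases by metis
  with w have "(of_int (int n) :: complex) = of_int (int p * k)" by simp
  then have "int n = int p * k" by (simp only: of_int_eq_iff)
  then have "int p dvd int n" by simp
  with assms show False by simp
qed

lemma root_of_unity_cong_imp_eq:
  assumes "n > 0" "x ^ n = 1" "y ^ n = 1" "alg_int_cong p x y" "\<not> p dvd n"
  shows "x = y"
  \<comment> \<open>The cofactor \<open>(X\<^sup>n - y\<^sup>n) / (X - y)\<close> vanishes at \<open>x \<noteq> y\<close> and takes the value \<open>n y\<^bsup>n-1\<^esup>\<close> at \<open>y\<close>.\<close>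
proof (rule ccontr)
  assume "x \<noteq> y"
  have alg: "algebraic_int x" "algebraic_int y"
    using assms algebraic_int_root_of_unity by blast+
  have "0 = (x - y) * (\<Sum>i<n. y ^ (n - Suc i) * x ^ i)"
    using power_diff_sumr2[of x n y] assms by simp
  then have "(\<Sum>i<n. y ^ (n - Suc i) * x ^ i) = 0" using \<open>x \<noteq> y\<close> by simp
  moreover have "alg_int_cong p (\<Sum>i<n. y ^ (n - Suc i) * x ^ i) (\<Sum>i<n. y ^ (n - Suc i) * y ^ i)"
    using assms alg
    by (intro alg_int_cong_sum alg_int_cong_mult alg_int_cong_refl alg_int_cong_power
        algebraic_int_power)
  moreover have "(\<Sum>i<n. y ^ (n - Suc i) * y ^ i) = of_nat n * y ^ (n - 1)"
    by (simp add: power_add[symmetric])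
  ultimately have "alg_int_cong p (of_nat n * y ^ (n - 1)) 0"
    by (simp add: alg_int_cong_sym)
  \<comment> \<open>Multiplication by \<open>y\<close> completes the unit \<open>y ^ (n - 1)\<close>
    to \<open>y ^ n = 1\<close> and leaves the bare integer \<open>n\<close>.\<close>
  then have "alg_int_cong p (of_nat n * y ^ (n - 1) * y) (0 * y)"
    using alg by (intro alg_int_cong_mult alg_int_cong_refl) auto
  moreover have "y ^ (n - 1) * y = 1"
    using assms by (metis One_nat_def Suc_pred power_Suc2)
  ultimately have "alg_int_cong p (of_nat n) 0" by (simp add: mult.assoc)
  with not_alg_int_cong_0 assms show False by blast
qed

text \<open>Two candidates for the symbol are congruent to each other modulo \<open>p\<close>, hence
  equal when \<open>p\<close> does not divide \<open>n\<close>. Exhibiting one candidate therefore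
  determines the definite description.\<close>

lemma power_residue_symbol_eqI:
  assumes "n > 0" "\<not> p dvd n" "z ^ n = 1"
    and "alg_int_cong p (of_int b ^ ((p - 1) div n)) z"
  shows "power_residue_symbol b p n = z"
  unfolding power_residue_symbol_def
  using assms root_of_unity_cong_imp_eq alg_int_cong_trans alg_int_cong_sym
  by (intro the_equality) blast+

section \<open>Power residues\<close>

lemma is_power_residue_cong:
  "[b = c] (mod int p) \<Longrightarrow> is_power_residue m p b \<longleftrightarrow> is_power_residue m p c"
  unfolding is_power_residue_def by (metis cong_sym cong_trans)

lemma is_power_residue_mult:
  assumes "prime p" "is_power_residue m p b" "is_power_residue m p c"
  shows "is_power_residue m p (b * c)"
proof -
  obtain x y where "[x ^ m = b] (mod int p)" "[y ^ m = c] (mod int p)"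
    using assms unfolding is_power_residue_def by auto
  then have "[(x * y) ^ m = b * c] (mod int p)" by (simp add: power_mult_distrib cong_mult)
  moreover have "\<not> [b * c = 0] (mod int p)"
    using assms by (auto simp: is_power_residue_def cong_0_iff prime_dvd_mult_iff)
  ultimately show ?thesis unfolding is_power_residue_def by blast
qed

lemma mod_in_power_residues_iff:
  assumes "p > 0"
  shows "k mod p \<in> power_residues m p \<longleftrightarrow> is_power_residue m p (int k)"
proof -
  have "is_power_residue m p (int (k mod p)) \<longleftrightarrow> is_power_residue m p (int k)"
    by (rule is_power_residue_cong) (simp add: zmod_int)
  moreover have "k mod p > 0" if "is_power_residue m p (int k)"
    using that by (auto simp: is_power_residue_def cong_0_iff intro!: Nat.gr0I)
  moreover have "k mod p \<le> p - 1" using assms by (simp add: less_Suc_eq_le[symmetric])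
  ultimately show ?thesis by (auto simp: power_residues_def)
qed

lemma power_residues_bounds:
  "k \<in> power_residues m p \<Longrightarrow> 0 < k" "k \<in> power_residues m p \<Longrightarrow> k < p"
  by (auto simp: power_residues_def)

lemma finite_power_residues [simp]: "finite (power_residues m p)"
  by (simp add: power_residues_def)

text \<open>For a primitive root \<open>g\<close>, the residues form the subgroup generated by
  \<open>g ^ m\<close> in a cyclic group of order \<open>m * q\<close>; the exponents
  \<open>m * j\<close> with \<open>j < q\<close> list it once.\<close>

lemma card_power_residues:
  assumes p: "prime p" and m: "m > 0" and dvd: "p - 1 = m * q"
  shows "card (power_residues m p) = q"
proof -
  have p1: "p > 1" using p prime_gt_1_nat by blast
  obtain g where g: "residue_primroot p g" using prime_primitive_root_exists[of p] p p1 by auto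
  have bij: "bij_betw (\<lambda>i. g ^ i mod p) {..<p - 1} {0<..<p}"
    using residue_primroot_is_generator[OF p1 g] p by (simp add: totient_prime totatives_prime)
  have cop: "coprime p g" using g by (simp add: residue_primroot_def)
  have ordg: "ord p g = m * q" using g p dvd by (simp add: residue_primroot_def totient_prime)
  have q: "q > 0" using dvd p1 by (intro Nat.gr0I) auto
  have "power_residues m p = (\<lambda>j. g ^ (m * j) mod p) ` {..<q}"
  proof (intro equalityI subsetI)
    fix k assume "k \<in> (\<lambda>j. g ^ (m * j) mod p) ` {..<q}"
    then obtain j where k: "k = g ^ (m * j) mod p" by auto
    have "\<not> p dvd g ^ (m * j)" 
      using cop p1 coprime_absorb_left[of p "g ^ (m * j)"] by auto
    then have "is_power_residue m p (int (g ^ (m * j)))"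
      unfolding is_power_residue_def cong_0_iff int_dvd_int_iff
      by (intro conjI exI[of _ "int (g ^ j)"]) (auto simp: power_mult[symmetric] mult.commute)
    then show "k \<in> power_residues m p" using p1 k by (simp add: mod_in_power_residues_iff)
  next
    fix k assume k: "k \<in> power_residues m p"
    then obtain x where x: "[x ^ m = int k] (mod int p)" "\<not> [int k = 0] (mod int p)"
      by (auto simp: power_residues_def is_power_residue_def)
    \<comment> \<open>The root \<open>x\<close> is an integer, while the primitive root enumerates
      natural numbers below \<open>p\<close>; \<open>y\<close> is the representative of
      \<open>x\<close> there.\<close>
    define y where "y = nat (x mod int p)"
    have y: "int y = x mod int p" using p1 by (simp add: y_def)
    have "\<not> int p dvd x"
    proof
      assume "int p dvd x"
      then have "int p dvd x ^ m" using m by (meson dvd_power dvd_trans)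
      then show False using x by (metis cong_0_iff cong_dvd_iff)
    qed
    then have "y \<noteq> 0" using y by (metis dvd_eq_mod_eq_0 of_nat_0)
    moreover have "y < p" using p1 y by (simp add: y_def nat_less_iff)
    ultimately have "y \<in> (\<lambda>i. g ^ i mod p) ` {..<p - 1}"
      using bij_betw_imp_surj_on[OF bij] by simp
    then obtain i where i: "g ^ i mod p = y" by auto
    have "[int (y ^ m) = int k] (mod int p)"
      using x(1) y by (metis cong_def of_nat_power power_mod)
    then have "[y ^ m = k] (mod p)" by (simp only: cong_int_iff)
    then have "[(g ^ i) ^ m = k] (mod p)" using i by (metis cong_def power_mod)
    \<comment> \<open>The order of \<open>g\<close> is \<open>m * q\<close>, and reducing
      \<open>i\<close> modulo \<open>q\<close> changes \<open>m * i\<close> by a multiple of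
      it.\<close>
    moreover have "[g ^ (m * i) = g ^ (m * (i mod q))] (mod p)"
      unfolding order_divides_expdiff[OF cop] ordg
      by (simp only: cong_def mult_mod_right[symmetric] mod_mod_trivial)
    ultimately have "[g ^ (m * (i mod q)) = k] (mod p)"
      by (metis cong_sym cong_trans mult.commute power_mult)
    then have "g ^ (m * (i mod q)) mod p = k"
      using power_residues_bounds[OF k] by (simp add: cong_def)
    then show "k \<in> (\<lambda>j. g ^ (m * j) mod p) ` {..<q}" using q by (intro image_eqI[of _ _ "i mod q"]) auto
  qed
  moreover have "inj_on (\<lambda>j. g ^ (m * j) mod p) {..<q}"
  proof (rule inj_onI)
    fix i j assume ij: "i \<in> {..<q}" "j \<in> {..<q}" "g ^ (m * i) mod p = g ^ (m * j) mod p"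
    then have "m * i \<in> {..<p - 1}" "m * j \<in> {..<p - 1}" using m dvd by auto
    then have "m * i = m * j" using bij_betw_imp_inj_on[OF bij] ij(3) by (auto dest: inj_onD)
    then show "i = j" using m by simp
  qed
  ultimately show ?thesis by (simp add: card_image)
qed

text \<open>With p - 1 = 2mn, the element g^(mn) is the square root of 1 other than 1, that is -1,
  and it is the m-th power of g^n.\<close>

lemma is_power_residue_minus_one:
  assumes p: "prime p" and m: "m > 0" and cong: "[p = 1] (mod (2 * m))"
  shows "is_power_residue m p (- 1)"
proof -
  have p1: "p > 1" using p prime_gt_1_nat by blast
  have "2 * m dvd p - 1" using cong p1 by (simp add: cong_altdef_nat cong_sym_eq)
  then obtain n where n: "p - 1 = 2 * m * n" by (elim dvdE)
  have npos: "n > 0" using n p1 by (intro Nat.gr0I) auto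
  obtain g where g: "residue_primroot p g" using prime_primitive_root_exists[of p] p p1 by auto
  have cop: "coprime p g" using g by (simp add: residue_primroot_def)
  have ordg: "ord p g = 2 * m * n" using g p n by (simp add: residue_primroot_def totient_prime)
  define h where "h = g ^ (m * n)"
  have "\<not> 2 * m * n dvd m * n" using m npos by (auto dest!: dvd_imp_le)
  then have "\<not> [h = 1] (mod p)"
    unfolding h_def ord_divides ordg .
  moreover have "[h ^ 2 = 1] (mod p)"
    using ord[of g p] ordg by (simp add: h_def power_mult[symmetric] mult_ac)
  ultimately have "[int h = - 1] (mod int p)"
  proof -
    assume a: "\<not> [h = 1] (mod p)" "[h ^ 2 = 1] (mod p)"
    have "[int (h ^ 2) = int 1] (mod int p)" using a(2) by (simp only: cong_int_iff)
    then have "int p dvd (int h - 1) * (int h + 1)"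
      by (simp add: cong_iff_dvd_diff power2_eq_square algebra_simps)
    moreover have "\<not> int p dvd int h - 1"
      using a(1) by (metis cong_iff_dvd_diff cong_int_iff of_nat_1)
    ultimately show ?thesis using p by (auto simp: prime_dvd_mult_iff cong_iff_dvd_diff)
  qed
  moreover have "int h = int (g ^ n) ^ m" by (simp add: h_def power_mult[symmetric] mult.commute)
  moreover have "\<not> [- 1 = 0] (mod int p)" using p1 by (simp add: cong_0_iff)
  ultimately show ?thesis unfolding is_power_residue_def by metis
qed

lemma diff_in_power_residues:
  assumes "prime p" "is_power_residue m p (- 1)" "k \<in> power_residues m p"
  shows "p - k \<in> power_residues m p"
proof -
  have k: "0 < k" "k < p" using power_residues_bounds[OF assms(3)] by auto
  have "is_power_residue m p (- 1 * int k)"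
    using assms by (intro is_power_residue_mult) (auto simp: power_residues_def)
  moreover have "[- 1 * int k = int (p - k)] (mod int p)"
    using k by (simp add: cong_iff_dvd_diff of_nat_diff)
  ultimately have "is_power_residue m p (int (p - k))" using is_power_residue_cong by blast
  then show ?thesis using k by (auto simp: power_residues_def)
qed

text \<open>Multiplication by a residue \<open>c\<close> permutes the residue classes in question,
  and the periodicity of \<open>f\<close> absorbs the reduction modulo \<open>p\<close>.\<close>

lemma prod_power_residues_mult:
  assumes p: "prime p" and c: "is_power_residue m p (int c)"
    and per: "\<And>k. f (k mod p) = f k"
  shows "(\<Prod>k\<in>power_residues m p. f (c * k)) = (\<Prod>k\<in>power_residues m p. f k)"
proof -
  have p0: "p > 0" using p prime_gt_0_nat by blast
  have cop: "coprime c p"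
    using c p prime_imp_coprime[of p c] by (simp add: is_power_residue_def cong_0_iff coprime_commute)
  have inj: "inj_on (\<lambda>k. c * k mod p) (power_residues m p)"
  proof (rule inj_onI)
    fix k l assume kl: "k \<in> power_residues m p" "l \<in> power_residues m p" "c * k mod p = c * l mod p"
    then have "[k = l] (mod p)" using cop by (simp add: cong_def[symmetric] cong_mult_lcancel_nat)
    then show "k = l" using kl(1,2)[THEN power_residues_bounds(2)] by (simp add: cong_def)
  qed
  have "(\<lambda>k. c * k mod p) ` power_residues m p \<subseteq> power_residues m p"
  proof (rule image_subsetI)
    fix k assume "k \<in> power_residues m p"
    then have "is_power_residue m p (int c * int k)"
      using p c by (intro is_power_residue_mult) (auto simp: power_residues_def)
    then show "c * k mod p \<in> power_residues m p"
      using p0 by (simp add: mod_in_power_residues_iff)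
  qed
  then have "bij_betw (\<lambda>k. c * k mod p) (power_residues m p) (power_residues m p)"
    using inj by (simp add: bij_betw_def endo_inj_surj)
  from prod.reindex_bij_betw[OF this, of f] show ?thesis by (simp add: per)
qed

section \<open>The pairing of k with p - k\<close>

definition lower_power_residues :: "nat \<Rightarrow> nat \<Rightarrow> nat set" where
  "lower_power_residues m p = {k \<in> power_residues m p. 2 * k < p}"

lemma power_residues_split:
  assumes "prime p" "odd p" "is_power_residue m p (- 1)"
  shows "power_residues m p = lower_power_residues m p \<union> (\<lambda>k. p - k) ` lower_power_residues m p"
    and "lower_power_residues m p \<inter> (\<lambda>k. p - k) ` lower_power_residues m p = {}"
    and "inj_on (\<lambda>k. p - k) (lower_power_residues m p)"
proof -
  show "power_residues m p = lower_power_residues m p \<union> (\<lambda>k. p - k) ` lower_power_residues m p"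
  proof (intro equalityI subsetI)
    fix k assume k: "k \<in> power_residues m p"
    have b: "0 < k" "k < p" using power_residues_bounds[OF k] by auto
    show "k \<in> lower_power_residues m p \<union> (\<lambda>k. p - k) ` lower_power_residues m p"
    proof (cases "2 * k < p")
      case False
      \<comment> \<open>Oddness of \<open>p\<close> excludes a fixed point
        \<open>k = p - k\<close>.\<close>
      then have "2 * k \<noteq> p" "2 * k \<ge> p" using assms by auto
      then have "p - k \<in> lower_power_residues m p"
        using diff_in_power_residues[OF assms(1,3) k] b by (simp add: lower_power_residues_def)
      then show ?thesis using b by (intro UnI2 image_eqI[of _ _ "p - k"]) auto
    qed (simp add: lower_power_residues_def k)
  next
    fix k assume "k \<in> lower_power_residues m p \<union> (\<lambda>k. p - k) ` lower_power_residues m p"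
    then show "k \<in> power_residues m p"
      using diff_in_power_residues[OF assms(1,3)] by (auto simp: lower_power_residues_def)
  qed
  show "lower_power_residues m p \<inter> (\<lambda>k. p - k) ` lower_power_residues m p = {}"
    by (auto simp: lower_power_residues_def)
  show "inj_on (\<lambda>k. p - k) (lower_power_residues m p)"
    by (rule inj_onI) (auto simp: lower_power_residues_def)
qed

lemma finite_lower_power_residues [simp]: "finite (lower_power_residues m p)"
  by (simp add: lower_power_residues_def)

lemma prod_power_residues_split:
  assumes "prime p" "odd p" "is_power_residue m p (- 1)"
  shows "(\<Prod>k\<in>power_residues m p. f k) = (\<Prod>k\<in>lower_power_residues m p. f k * f (p - k))"
  by (simp add: power_residues_split(1)[OF assms] prod.union_disjoint power_residues_split(2)[OF assms]
      prod.reindex[OF power_residues_split(3)[OF assms]] prod.distrib)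

lemma card_power_residues_split:
  assumes "prime p" "odd p" "is_power_residue m p (- 1)"
  shows "card (power_residues m p) = 2 * card (lower_power_residues m p)"
  by (subst power_residues_split(1)[OF assms])
     (simp add: card_Un_disjoint power_residues_split(2)[OF assms]
      card_image[OF power_residues_split(3)[OF assms]])

text \<open>If \<open>k\<close> and \<open>p\<close> were coprime, Bezout would write
  \<open>z\<close> in terms of \<open>z ^ k\<close> and \<open>z ^ p\<close>, giving
  \<open>z = 1\<close>.\<close>

lemma power_eq_1_imp_dvd:
  fixes z :: "'a :: idom"
  assumes "prime p" "z ^ p = 1" "z \<noteq> 1" "z ^ k = 1"
  shows "p dvd k"
proof (rule ccontr)
  assume "\<not> p dvd k"
  then have cop: "coprime k p" using assms prime_imp_coprime[of p k] by (simp add: coprime_commute)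
  have "k \<noteq> 0" using \<open>\<not> p dvd k\<close> by (metis dvd_0_right)
  then obtain x y where "k * x = p * y + gcd k p" using bezout_nat by blast
  then have "k * x = p * y + 1" using cop by simp
  then have "z ^ (k * x) = z ^ (p * y) * z" by (simp add: power_add)
  then show False using assms by (simp add: power_mult)
qed

section \<open>The products\<close>

text \<open>An arbitrary nontrivial p-th root of unity \<open>z\<close> stands for the exponential,
  so that the integer a enters only in the final theorem.\<close>

lemma prod_power_residues:
  fixes z :: complex
  assumes m: "m > 0" and p: "prime p" and cong: "[p = 1] (mod (2 * m))"
    and two: "is_power_residue m p 2" and z: "z ^ p = 1" "z \<noteq> 1"
  shows "(\<Prod>k\<in>power_residues m p. \<i> - z ^ k)
           = power_residue_symbol (-2) p (2 * m) * \<i> ^ ((p - 1) div (2 * m))" (is "?A = _")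
    and "(\<Prod>k\<in>power_residues m p. \<i> + z ^ k)
           = power_residue_symbol 2 p (2 * m) * \<i> ^ ((p - 1) div (2 * m))" (is "?B = _")
proof -
  let ?R = "power_residues m p" and ?H = "lower_power_residues m p"
  have p1: "p > 1" using p prime_gt_1_nat by blast
  have "2 * m dvd p - 1" using cong p1 by (simp add: cong_altdef_nat cong_sym_eq)
  then obtain n where n: "p - 1 = 2 * m * n" by (elim dvdE)
  have p_eq: "p = Suc (2 * m * n)" using n p1 by simp
  have odd: "odd p" by (simp add: p_eq)
  have n': "(p - 1) div (2 * m) = n" using n m by simp
  \<comment> \<open>Here \<open>n = 0\<close> would give \<open>p = 1\<close>, and otherwise
    \<open>2 * m < p\<close>. This secures the uniqueness of the symbols of order
    \<open>2 * m\<close>.\<close>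
  have ndvd: "\<not> p dvd 2 * m" using p_eq m p1
    by (cases n) (auto dest!: dvd_imp_le)
  have neg: "is_power_residue m p (- 1)" by (rule is_power_residue_minus_one[OF p m cong])
  have cardR: "card ?R = 2 * n" by (rule card_power_residues[OF p m]) (simp add: n[unfolded One_nat_def])
  then have cardH: "card ?H = n" using card_power_residues_split[OF p odd neg] by simp
  have per: "z ^ (k mod p) = z ^ k" for k
  proof -
    have "z ^ k = z ^ (p * (k div p) + k mod p)" by simp
    also have "\<dots> = z ^ (k mod p)" unfolding power_add power_mult z(1) by simp
    finally show ?thesis ..
  qed
  define C where "C = (\<Prod>k\<in>?H. z ^ k + z ^ (p - k))"
  have inv: "z ^ k * z ^ (p - k) = 1" if "k \<in> ?H" for k
    using that z(1) by (simp add: power_add[symmetric] lower_power_residues_def)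
  \<comment> \<open>In each paired product the constants \<open>\<i> ^ 2 = -1\<close> and
    \<open>z ^ k * z ^ (p - k) = 1\<close> cancel, leaving only the mixed terms.\<close>
  have "?A = (\<Prod>k\<in>?H. - \<i> * (z ^ k + z ^ (p - k)))"
    unfolding prod_power_residues_split[OF p odd neg]
  proof (rule prod.cong)
    fix k assume "k \<in> ?H"
    from inv[OF this] show "(\<i> - z ^ k) * (\<i> - z ^ (p - k)) = - \<i> * (z ^ k + z ^ (p - k))"
      by (simp add: algebra_simps)
  qed simp
  then have A: "?A = (- \<i>) ^ n * C" by (simp only: prod.distrib prod_constant C_def cardH)
  have "?B = (\<Prod>k\<in>?H. \<i> * (z ^ k + z ^ (p - k)))"
    unfolding prod_power_residues_split[OF p odd neg]
  proof (rule prod.cong)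
    fix k assume "k \<in> ?H"
    from inv[OF this] show "(\<i> + z ^ k) * (\<i> + z ^ (p - k)) = \<i> * (z ^ k + z ^ (p - k))"
      by (simp add: algebra_simps)
  qed simp
  then have B: "?B = \<i> ^ n * C" by (simp only: prod.distrib prod_constant C_def cardH)
  have two': "is_power_residue m p (int 2)" using two by simp
  have "?A * ?B = (\<Prod>k\<in>?R. - 1 * (1 + z ^ (2 * k)))"
    unfolding prod.distrib[symmetric]
    by (intro prod.cong) (simp_all add: algebra_simps power2_eq_square power_mult)
  \<comment> \<open>The number of factors is \<open>2 * n\<close>, so the signs multiply to
    1.\<close>
  also have "\<dots> = (\<Prod>k\<in>?R. 1 + z ^ (2 * k))"
    unfolding prod.distrib[of "\<lambda>_. - 1"] prod_constant cardR by simp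
  also have "\<dots> = (\<Prod>k\<in>?R. 1 + z ^ k)"
    by (rule prod_power_residues_mult[OF p two']) (simp add: per)
  also have "\<dots> = 1"
  proof -
    \<comment> \<open>The telescoping is done without division: doubling permutes the residues once
      more, and the common factor is cancelled after it is shown to be nonzero.\<close>
    have "(\<Prod>k\<in>?R. 1 - z ^ k) * (\<Prod>k\<in>?R. 1 + z ^ k) = (\<Prod>k\<in>?R. 1 - z ^ (2 * k))"
      unfolding prod.distrib[symmetric]
      by (intro prod.cong) (simp_all add: algebra_simps power2_eq_square power_mult)
    also have "\<dots> = (\<Prod>k\<in>?R. 1 - z ^ k)"
      by (rule prod_power_residues_mult[OF p two']) (simp add: per)
    finally have "(\<Prod>k\<in>?R. 1 - z ^ k) * (\<Prod>k\<in>?R. 1 + z ^ k) = (\<Prod>k\<in>?R. 1 - z ^ k)" .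
    moreover have "(\<Prod>k\<in>?R. 1 - z ^ k) \<noteq> 0"
    proof
      assume "(\<Prod>k\<in>?R. 1 - z ^ k) = 0"
      then obtain k where k: "k \<in> ?R" "z ^ k = 1" by auto
      then have "p dvd k" using power_eq_1_imp_dvd p z by blast
      with power_residues_bounds[OF k(1)] show False by (auto dest: dvd_imp_le)
    qed
    ultimately show ?thesis by simp
  qed
  finally have "((- \<i>) * \<i>) ^ n * C ^ 2 = 1"
    by (simp only: A B power_mult_distrib power2_eq_square mult_ac)
  moreover have "- \<i> * \<i> = 1" by simp
  ultimately have C2: "C ^ 2 = 1" by (simp only: power_one mult_1)
  have alg: "algebraic_int (z ^ k)" for k
    using algebraic_int_root_of_unity[OF _ z(1)] p1 by (intro algebraic_int_power) auto
  have "alg_int_cong p (\<Prod>k\<in>?H. (z ^ k + z ^ (p - k)) ^ p) (\<Prod>k\<in>?H. 2)"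
  proof (rule alg_int_cong_prod)
    fix k assume "k \<in> ?H"
    have "(z ^ l) ^ p = 1" for l
      using z(1) by (metis mult.commute power_mult power_one)
    then show "alg_int_cong p ((z ^ k + z ^ (p - k)) ^ p) 2"
      using alg_int_cong_frobenius[OF p alg alg, of k "p - k"] by simp
  qed (auto intro: alg algebraic_int_power algebraic_int_add)
  then have "alg_int_cong p (C ^ p) (2 ^ n)"
    by (simp add: C_def cardH prod_power_distrib)
  \<comment> \<open>As \<open>p\<close> is odd and \<open>C ^ 2 = 1\<close>, the power collapses to
    \<open>C\<close>.\<close>
  moreover have "C ^ p = C"
    using C2 by (simp add: p_eq power_mult mult.assoc)
  ultimately have C: "alg_int_cong p (2 ^ n) C" by (simp add: alg_int_cong_sym)
  have "power_residue_symbol 2 p (2 * m) = C"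
  proof (rule power_residue_symbol_eqI)
    \<comment> \<open>The even order \<open>2 * m\<close> admits both possible values 1 and -1 of
      \<open>C\<close>.\<close>
    show "C ^ (2 * m) = 1" by (simp only: power_mult C2 power_one)
    show "alg_int_cong p (of_int 2 ^ ((p - 1) div (2 * m))) C" unfolding n' using C by simp
  qed (use m ndvd in auto)
  then show "?B = power_residue_symbol 2 p (2 * m) * \<i> ^ ((p - 1) div (2 * m))"
    unfolding n' by (simp add: B)
  \<comment> \<open>The sign from \<open>(- 2) ^ n = (- 1) ^ n * 2 ^ n\<close> is the one by which
    \<open>(- \<i>) ^ n\<close> in the first product differs from \<open>\<i> ^ n\<close>.\<close>
  have "power_residue_symbol (- 2) p (2 * m) = (- 1) ^ n * C"
  proof (rule power_residue_symbol_eqI)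
    have "((- 1) ^ n * C) ^ 2 = 1" using C2 by (simp add: power_mult_distrib power_mult[symmetric])
    then show "((- 1) ^ n * C) ^ (2 * m) = 1" by (simp only: power_mult power_one)
    have "alg_int_cong p ((- 1) ^ n * 2 ^ n) ((- 1) ^ n * C)"
      using C by (intro alg_int_cong_mult alg_int_cong_refl) (auto intro: algebraic_int_power)
    then show "alg_int_cong p (of_int (- 2) ^ ((p - 1) div (2 * m))) ((- 1) ^ n * C)"
      unfolding n' by (simp add: power_mult_distrib[symmetric])
  qed (use m ndvd in auto)
  moreover have "(- \<i>) ^ n = (- 1) ^ n * \<i> ^ n" by (simp add: power_mult_distrib[symmetric])
  ultimately show "?A = power_residue_symbol (- 2) p (2 * m) * \<i> ^ ((p - 1) div (2 * m))"
    unfolding n' by (simp add: A)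
qed

theorem theorem1p2:
  fixes m p :: nat and a :: int
  assumes "m > 0"
    and "prime p"
    and "[p = 1] (mod (2 * m))"
    and "is_power_residue m p 2"
    and "\<not> [a = 0] (mod int p)"
  shows "(\<Prod>k\<in>power_residues m p.
            \<i> - exp (2 * of_real pi * \<i> * of_int a * of_nat k / of_nat p))
         = power_residue_symbol (-2) p (2 * m) * \<i> ^ ((p - 1) div (2 * m))
       \<and> (\<Prod>k\<in>power_residues m p.
            \<i> + exp (2 * of_real pi * \<i> * of_int a * of_nat k / of_nat p))
         = power_residue_symbol 2 p (2 * m) * \<i> ^ ((p - 1) div (2 * m))"
proof -
  define z where "z = exp (2 * of_real pi * \<i> * of_int a / of_nat p :: complex)"
  have p0: "p > 0" using assms prime_gt_0_nat by blast
  have z: "exp (2 * of_real pi * \<i> * of_int a * of_nat k / of_nat p) = z ^ k" for k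
    unfolding z_def exp_of_nat_mult[symmetric] by (simp add: field_simps)
  have "z ^ p = exp (2 * of_real pi * \<i> * of_int a)"
    using p0 by (simp add: z[symmetric])
  also have "\<dots> = 1" by (auto simp: exp_eq_1)
  finally have "z ^ p = 1" .
  moreover have "z \<noteq> 1"
  proof
    \<comment> \<open>The exponent would be an integer multiple of \<open>2 * pi * \<i>\<close>,
      which makes a/p an integer, against the hypothesis on \<open>a\<close>.\<close>
    assume "z = 1"
    then obtain n :: int where "2 * pi * a / p = of_int (2 * n) * pi"
      unfolding z_def exp_eq_1 by auto
    then have "real_of_int a = of_int (n * int p)" using p0 by (simp add: field_simps)
    then have "a = n * int p" by (simp only: of_int_eq_iff)
    with assms(5) show False by (simp add: cong_0_iff)
  qed
  ultimately show ?thesis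
    unfolding z using prod_power_residues[OF assms(1-4)] by blast
qed

end
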